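(* For every connected graph $G$, $c(G) \le \xi(G) \le \Delta(G)\,\gamma(G)$.
   Context: Graphs are finite, simple and undirected. $\Delta(G)$ is the maximum degree of $G$. A dominating set of $G$ is a set $S \subseteq V(G)$ such that for all $v \in V(G)$ there is $w \in S$ with $d(v,w) \le 1$; the domination number $\gamma(G)$ is the size of a smallest dominating set. Cops and Robber: on a connected graph $G$, $k \ge 1$ cops first choose vertices (several cops may share a vertex), then the robber chooses a vertex. They then alternate turns, cops first, with full information; on the cops' turn each cop stays put or moves to an adjacent vertex, and on the robber's turn he stays put or moves to an adjacent vertex. The cops win if at some time a cop occupies the same vertex as the robber. The cop number $c(G)$ is the smallest positive integer $k$ such that $k$ cops have a winning strategy on $G$. Containment: on a connected graph $G$, $k$ cops are first placed on edges of $G$ (several cops may share an edge), then the robber chooses a vertex. They then alternate turns, cops first, with full information. On the cops' turn each cop stays put or moves to an adjacent edge (an edge sharing an endpoint with her current edge; moving through a vertex occupied by the robber is allowed). On the robber's turn he stays put or moves to an adjacent vertex along an edge not currently occupied by a cop. The cops win (contain the robber) if at some time it is the robber's turn and every edge incident with the robber's vertex is occupied by at least one cop. $G$ is $k$-cop-containable if $k$ cops have a strategy guaranteeing a win, and the containability number $\xi(G)$ is the smallest $k$ such that $G$ is $k$-cop-containable.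
   Formalization: The inequality c(G) ≤ ξ(G) is stated for connected graphs with at least two vertices, since for the one-vertex graph c = 1 but Δγ = 0, so the chain fails; ξ(G) ≤ Δ(G)γ(G) is stated for every connected graph. *)

theory Defs
  imports Main "HOL-Library.Extended_Nat"
begin

text \<open>A graph is given by its vertex set \<open>V\<close> and its set \<open>E\<close> of edges, an edge being the
  two-element set of its endpoints.\<close>

definition simple_graph :: "'a set \<Rightarrow> 'a set set \<Rightarrow> bool" where
  "simple_graph V E \<longleftrightarrow>
     finite V \<and> V \<noteq> {} \<and> (\<forall>e\<in>E. \<exists>u\<in>V. \<exists>v\<in>V. u \<noteq> v \<and> e = {u, v})"

definition adj_rel :: "'a set set \<Rightarrow> ('a \<times> 'a) set" where
  "adj_rel E = {(u, v). {u, v} \<in> E}"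

definition connected_graph :: "'a set \<Rightarrow> 'a set set \<Rightarrow> bool" where
  "connected_graph V E \<longleftrightarrow>
     simple_graph V E \<and> (\<forall>u\<in>V. \<forall>v\<in>V. (u, v) \<in> (adj_rel E)\<^sup>*)"

definition degree :: "'a set set \<Rightarrow> 'a \<Rightarrow> nat" where
  "degree E v = card {e \<in> E. v \<in> e}"

definition max_degree :: "'a set \<Rightarrow> 'a set set \<Rightarrow> nat" where
  "max_degree V E = Max (degree E ` V)"

definition gdist :: "'a set set \<Rightarrow> 'a \<Rightarrow> 'a \<Rightarrow> enat" where
  "gdist E u v = (INF n \<in> {n. (u, v) \<in> adj_rel E ^^ n}. enat n)"

definition dominating_set :: "'a set \<Rightarrow> 'a set set \<Rightarrow> 'a set \<Rightarrow> bool" where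
  "dominating_set V E S \<longleftrightarrow> S \<subseteq> V \<and> (\<forall>v\<in>V. \<exists>w\<in>S. gdist E v w \<le> 1)"

definition domination_number :: "'a set \<Rightarrow> 'a set set \<Rightarrow> nat" where
  "domination_number V E = Min (card ` {S. dominating_set V E S})"

text \<open>A strategy \<open>\<sigma>\<close> for the cops maps the list of the robber's positions so far to the positions
  of the cops, cop \<open>i\<close> being at \<open>\<sigma> h i\<close> (only \<open>i < k\<close> matters when there are \<open>k\<close> cops).  The
  earlier positions of the cops are themselves determined by \<open>\<sigma>\<close>, so this is a strategy with
  full information that may depend on the whole history.  If the robber is at
  \<open>r 0, r 1, \<dots>\<close>, the play is
  \<open>cops_at \<sigma> r 0, r 0, cops_at \<sigma> r 1, r 1, cops_at \<sigma> r 2, \<dots>\<close>: the two initial placements,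
  then alternating moves, cops first.  Plays are continued forever, also after the cops have won;
  this loses nothing, since both sides may always stay put.\<close>

definition cops_at :: "('a list \<Rightarrow> nat \<Rightarrow> 'p) \<Rightarrow> (nat \<Rightarrow> 'a) \<Rightarrow> nat \<Rightarrow> nat \<Rightarrow> 'p" where
  "cops_at \<sigma> r t = \<sigma> (map r [0..<t])"


subsection \<open>Cops and Robber\<close>

definition cr_robber_play :: "'a set \<Rightarrow> 'a set set \<Rightarrow> (nat \<Rightarrow> 'a) \<Rightarrow> bool" where
  "cr_robber_play V E r \<longleftrightarrow>
     r 0 \<in> V \<and> (\<forall>t. r (Suc t) = r t \<or> {r t, r (Suc t)} \<in> E)"

definition cr_legal_strategy ::
    "'a set \<Rightarrow> 'a set set \<Rightarrow> nat \<Rightarrow> ('a list \<Rightarrow> nat \<Rightarrow> 'a) \<Rightarrow> bool" where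
  "cr_legal_strategy V E k \<sigma> \<longleftrightarrow>
     (\<forall>i<k. \<sigma> [] i \<in> V) \<and>
     (\<forall>r. cr_robber_play V E r \<longrightarrow>
        (\<forall>t. \<forall>i<k. cops_at \<sigma> r (Suc t) i = cops_at \<sigma> r t i
                 \<or> {cops_at \<sigma> r t i, cops_at \<sigma> r (Suc t) i} \<in> E))"

text \<open>The two disjuncts are the positions after a move of the robber and after a move of the
  cops.\<close>

definition cr_captured :: "nat \<Rightarrow> ('a list \<Rightarrow> nat \<Rightarrow> 'a) \<Rightarrow> (nat \<Rightarrow> 'a) \<Rightarrow> bool" where
  "cr_captured k \<sigma> r \<longleftrightarrow>
     (\<exists>t. \<exists>i<k. cops_at \<sigma> r t i = r t \<or> cops_at \<sigma> r (Suc t) i = r t)"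

definition cops_win :: "'a set \<Rightarrow> 'a set set \<Rightarrow> nat \<Rightarrow> bool" where
  "cops_win V E k \<longleftrightarrow>
     (\<exists>\<sigma>. cr_legal_strategy V E k \<sigma> \<and> (\<forall>r. cr_robber_play V E r \<longrightarrow> cr_captured k \<sigma> r))"

text \<open>The cop number and the containability number take values in \<^typ>\<open>enat\<close>, so that they would
  be infinite, and not an unspecified number, if no number of cops sufficed.\<close>

definition cop_number :: "'a set \<Rightarrow> 'a set set \<Rightarrow> enat" where
  "cop_number V E = (INF k \<in> {k. 1 \<le> k \<and> cops_win V E k}. enat k)"


subsection \<open>Containment\<close>

text \<open>When the robber moves from \<open>r t\<close> to \<open>r (Suc t)\<close>, the cops are on the edges
  \<open>cops_at \<sigma> r (Suc t) i\<close>.\<close>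

definition ct_robber_play ::
    "'a set \<Rightarrow> 'a set set \<Rightarrow> nat \<Rightarrow> ('a list \<Rightarrow> nat \<Rightarrow> 'a set) \<Rightarrow> (nat \<Rightarrow> 'a) \<Rightarrow> bool" where
  "ct_robber_play V E k \<sigma> r \<longleftrightarrow>
     r 0 \<in> V \<and>
     (\<forall>t. r (Suc t) = r t
        \<or> ({r t, r (Suc t)} \<in> E \<and> (\<forall>i<k. cops_at \<sigma> r (Suc t) i \<noteq> {r t, r (Suc t)})))"

definition ct_legal_strategy ::
    "'a set \<Rightarrow> 'a set set \<Rightarrow> nat \<Rightarrow> ('a list \<Rightarrow> nat \<Rightarrow> 'a set) \<Rightarrow> bool" where
  "ct_legal_strategy V E k \<sigma> \<longleftrightarrow>
     (\<forall>i<k. \<sigma> [] i \<in> E) \<and>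
     (\<forall>r. ct_robber_play V E k \<sigma> r \<longrightarrow>
        (\<forall>t. \<forall>i<k. cops_at \<sigma> r (Suc t) i = cops_at \<sigma> r t i
                 \<or> (cops_at \<sigma> r (Suc t) i \<in> E
                    \<and> cops_at \<sigma> r t i \<inter> cops_at \<sigma> r (Suc t) i \<noteq> {})))"

definition ct_contained ::
    "'a set set \<Rightarrow> nat \<Rightarrow> ('a list \<Rightarrow> nat \<Rightarrow> 'a set) \<Rightarrow> (nat \<Rightarrow> 'a) \<Rightarrow> bool" where
  "ct_contained E k \<sigma> r \<longleftrightarrow>
     (\<exists>t. \<forall>e\<in>E. r t \<in> e \<longrightarrow> (\<exists>i<k. cops_at \<sigma> r (Suc t) i = e))"

definition cop_containable :: "'a set \<Rightarrow> 'a set set \<Rightarrow> nat \<Rightarrow> bool" where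
  "cop_containable V E k \<longleftrightarrow>
     (\<exists>\<sigma>. ct_legal_strategy V E k \<sigma> \<and> (\<forall>r. ct_robber_play V E k \<sigma> r \<longrightarrow> ct_contained E k \<sigma> r))"

definition containability_number :: "'a set \<Rightarrow> 'a set set \<Rightarrow> enat" where
  "containability_number V E = (INF k \<in> {k. cop_containable V E k}. enat k)"

end

theory Submission
  imports Defs
begin

text \<open>
  For the lower bound, each vertex cop shadows one edge cop of a winning containment strategy by
  always standing on an endpoint of its edge, and steps onto the robber whenever she is adjacent to
  him.  A robber crossing an occupied edge would start or end on the vertex of its shadow,
  so an uncaught robber plays legally in the containment game; once he is contained, a shadow is
  adjacent to him and he cannot leave.

  For the upper bound, let \<open>S\<close> be a minimum dominating set and put a cop on every edge meeting \<open>S\<close>;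
  these are at most \<open>\<Delta> \<gamma>\<close> edges.  If the robber starts at \<open>v\<close>, an edge \<open>{u, v}\<close> meeting \<open>S\<close> is
  occupied already; otherwise \<open>u\<close> has a neighbour \<open>w \<in> S\<close>, and the cop on \<open>{u, w}\<close> moves to
  \<open>{u, v}\<close>.  Hence he is contained after a single move of the cops.
\<close>

section \<open>Edges of simple graphs, and cop positions as functions of the past\<close>

lemma simple_graph_edge_eq:
  assumes "simple_graph V E" "e \<in> E" "a \<in> e" "b \<in> e" "a \<noteq> b"
  shows "e = {a, b}"
  using assms unfolding simple_graph_def by fastforce

lemma simple_graph_edgeD:
  assumes "simple_graph V E" "{u, v} \<in> E"
  shows "u \<in> V" "v \<in> V" "u \<noteq> v"
proof -
  obtain a b where "a \<in> V" "b \<in> V" "a \<noteq> b" "{u, v} = {a, b}"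
    using assms unfolding simple_graph_def by blast
  then show "u \<in> V" "v \<in> V" "u \<noteq> v" by (auto simp: doubleton_eq_iff)
qed

lemma cops_at_cong:
  assumes "\<And>s. s < t \<Longrightarrow> r s = r' s"
  shows "cops_at \<sigma> r t = cops_at \<sigma> r' t"
  unfolding cops_at_def by (rule arg_cong[where f = \<sigma>]) (use assms in auto)


subsection \<open>From containment to capture\<close>

text \<open>Capture takes precedence over following the edge \<open>e\<close>. The default
  \<open>q\<close> keeps the move legal where the shadow cannot follow, for instance on plays that
  break the rules of containment.\<close>

definition pursue :: "'a set set \<Rightarrow> 'a \<Rightarrow> 'a set \<Rightarrow> 'a \<Rightarrow> 'a" where
  "pursue E q e x =
     (if {q, x} \<in> E then x
      else if \<exists>v\<in>e. v = q \<or> {q, v} \<in> E then SOME v. v \<in> e \<and> (v = q \<or> {q, v} \<in> E)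
      else q)"

text \<open>The history is reversed here: the robber's latest position is at the head of the list.\<close>

fun shadow_rev :: "'a set set \<Rightarrow> ('a list \<Rightarrow> nat \<Rightarrow> 'a set) \<Rightarrow> 'a list \<Rightarrow> nat \<Rightarrow> 'a" where
  "shadow_rev E \<sigma> [] i = (SOME u. u \<in> \<sigma> [] i)"
| "shadow_rev E \<sigma> (x # h) i = pursue E (shadow_rev E \<sigma> h i) (\<sigma> (rev h @ [x]) i) x"

definition shadow :: "'a set set \<Rightarrow> ('a list \<Rightarrow> nat \<Rightarrow> 'a set) \<Rightarrow> 'a list \<Rightarrow> nat \<Rightarrow> 'a" where
  "shadow E \<sigma> h = shadow_rev E \<sigma> (rev h)"

lemma pursue_legal: "pursue E q e x = q \<or> {q, pursue E q e x} \<in> E"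
proof (cases "{q, x} \<notin> E \<and> (\<exists>v\<in>e. v = q \<or> {q, v} \<in> E)")
  case True
  then have "\<exists>v. v \<in> e \<and> (v = q \<or> {q, v} \<in> E)" by blast
  from someI_ex[OF this] show ?thesis using True by (simp add: pursue_def)
qed (auto simp: pursue_def)

lemma pursue_in:
  assumes "{q, x} \<notin> E" "v \<in> e" "v = q \<or> {q, v} \<in> E"
  shows "pursue E q e x \<in> e"
proof -
  have ex: "\<exists>v. v \<in> e \<and> (v = q \<or> {q, v} \<in> E)" using assms by blast
  from someI_ex[OF this] show ?thesis using assms(1) ex by (auto simp: pursue_def)
qed

lemma shadow_Suc:
  "cops_at (shadow E \<sigma>) r (Suc t) i =
     pursue E (cops_at (shadow E \<sigma>) r t i) (cops_at \<sigma> r (Suc t) i) (r t)"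
  by (simp add: cops_at_def shadow_def)

lemma cops_at_shadow_0:
  assumes "cops_at \<sigma> r 0 i \<noteq> {}"
  shows "cops_at (shadow E \<sigma>) r 0 i \<in> cops_at \<sigma> r 0 i"
  using assms by (simp add: cops_at_def shadow_def some_in_eq)

lemma shadow_legal:
  assumes "simple_graph V E" "ct_legal_strategy V E k \<sigma>"
  shows "cr_legal_strategy V E k (shadow E \<sigma>)"
  unfolding cr_legal_strategy_def
proof (intro conjI allI impI)
  fix i assume "i < k"
  then have "\<sigma> [] i \<in> E" using assms(2) by (simp add: ct_legal_strategy_def)
  then obtain u v where "u \<in> V" "v \<in> V" and e: "\<sigma> [] i = {u, v}"
    using assms(1) unfolding simple_graph_def by blast
  moreover have "shadow E \<sigma> [] i \<in> \<sigma> [] i" using e some_in_eq[of "\<sigma> [] i"] by (simp add: shadow_def)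
  ultimately show "shadow E \<sigma> [] i \<in> V" by auto
next
  fix r t i
  show "cops_at (shadow E \<sigma>) r (Suc t) i = cops_at (shadow E \<sigma>) r t i
      \<or> {cops_at (shadow E \<sigma>) r t i, cops_at (shadow E \<sigma>) r (Suc t) i} \<in> E"
    unfolding shadow_Suc by (rule pursue_legal)
qed

text \<open>Legality of a strategy speaks about infinite plays, so it is applied to the play in which the
  robber stays at \<open>r t\<close> forever.\<close>

lemma ct_legal_move:
  assumes "ct_legal_strategy V E k \<sigma>" "r 0 \<in> V" "i < k"
    and "\<And>s. s < t \<Longrightarrow> r (Suc s) = r s
        \<or> ({r s, r (Suc s)} \<in> E \<and> (\<forall>i<k. cops_at \<sigma> r (Suc s) i \<noteq> {r s, r (Suc s)}))"
  shows "cops_at \<sigma> r (Suc t) i = cops_at \<sigma> r t i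
      \<or> (cops_at \<sigma> r (Suc t) i \<in> E \<and> cops_at \<sigma> r t i \<inter> cops_at \<sigma> r (Suc t) i \<noteq> {})"
proof -
  define r' where "r' s = r (min s t)" for s
  \<comment> \<open>Cops at time \<open>s\<close> have seen the robber only before \<open>s\<close>,
    so agreement of \<open>r'\<close> and \<open>r\<close> up to \<open>t\<close> reaches the
    positions at \<open>Suc t\<close>.\<close>
  have cong: "cops_at \<sigma> r' s = cops_at \<sigma> r s" if "s \<le> Suc t" for s
    by (rule cops_at_cong) (use that in \<open>auto simp: r'_def min_def\<close>)
  have "ct_robber_play V E k \<sigma> r'"
    unfolding ct_robber_play_def
  proof (intro conjI allI)
    show "r' 0 \<in> V" using assms(2) by (simp add: r'_def)
    fix s
    show "r' (Suc s) = r' s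
        \<or> ({r' s, r' (Suc s)} \<in> E \<and> (\<forall>i<k. cops_at \<sigma> r' (Suc s) i \<noteq> {r' s, r' (Suc s)}))"
    proof (cases "s < t")
      case True
      then have "r' s = r s" "r' (Suc s) = r (Suc s)" by (auto simp: r'_def min_def)
      with assms(4)[OF True] cong[of "Suc s"] True show ?thesis by simp
    qed (simp add: r'_def min_def)
  qed
  then have "cops_at \<sigma> r' (Suc t) i = cops_at \<sigma> r' t i
      \<or> (cops_at \<sigma> r' (Suc t) i \<in> E \<and> cops_at \<sigma> r' t i \<inter> cops_at \<sigma> r' (Suc t) i \<noteq> {})"
    using assms(1,3) unfolding ct_legal_strategy_def by blast
  then show ?thesis using cong[of t] cong[of "Suc t"] by simp
qed

text \<open>Strong induction on time interlocks the claims: shadows on their edges make the robber's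
  moves so far legal, legality makes the next edge share a vertex with the old one, and the shadow
  follows through it.\<close>

lemma uncaptured_shadow:
  assumes G: "simple_graph V E" and legal: "ct_legal_strategy V E k \<sigma>"
    and r: "cr_robber_play V E r" and unc: "\<not> cr_captured k (shadow E \<sigma>) r"
  shows "i < k \<Longrightarrow> cops_at \<sigma> r t i \<in> E \<and> cops_at (shadow E \<sigma>) r t i \<in> cops_at \<sigma> r t i"
    and "ct_robber_play V E k \<sigma> r"
    and "i < k \<Longrightarrow> {cops_at (shadow E \<sigma>) r t i, r t} \<notin> E"
proof -
  let ?p = "cops_at (shadow E \<sigma>) r" and ?c = "cops_at \<sigma> r"
  have free: "?p t i \<noteq> r t" "?p (Suc t) i \<noteq> r t" if "i < k" for t i
    using unc that unfolding cr_captured_def by blast+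
  \<comment> \<open>A shadow adjacent to \<open>r t\<close> would step onto it by the first branch
    of \<open>pursue\<close>.\<close>
  have far: "{?p t i, r t} \<notin> E" if "i < k" for t i
    using free(2)[OF that, of t] unfolding shadow_Suc by (auto simp: pursue_def)
  then show "i < k \<Longrightarrow> {?p t i, r t} \<notin> E" .
  have move: "r (Suc s) = r s \<or> ({r s, r (Suc s)} \<in> E \<and> (\<forall>i<k. ?c (Suc s) i \<noteq> {r s, r (Suc s)}))"
    if "\<And>i. i < k \<Longrightarrow> ?p (Suc s) i \<in> ?c (Suc s) i" for s
  proof -
    have "?c (Suc s) i \<noteq> {r s, r (Suc s)}" if "i < k" for i
      using \<open>\<And>i. i < k \<Longrightarrow> ?p (Suc s) i \<in> ?c (Suc s) i\<close>[OF that] free(2)[OF that, of s]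
        free(1)[OF that, of "Suc s"] by auto
    then show ?thesis using r unfolding cr_robber_play_def by blast
  qed
  have inv: "\<forall>i<k. ?c t i \<in> E \<and> ?p t i \<in> ?c t i" for t
  proof (induction t rule: less_induct)
    case (less t)
    show ?case
    proof (intro allI impI)
      fix i assume i: "i < k"
      show "?c t i \<in> E \<and> ?p t i \<in> ?c t i"
      proof (cases t)
        case 0
        have "?c 0 i \<in> E" using legal i by (simp add: ct_legal_strategy_def cops_at_def)
        moreover from this have "?c 0 i \<noteq> {}" using G unfolding simple_graph_def by blast
        ultimately show ?thesis using cops_at_shadow_0 unfolding 0 by metis
      next
        case (Suc s)
        have IH: "?c s i \<in> E" "?p s i \<in> ?c s i" using less.IH[of s] i Suc by auto
        \<comment> \<open>Only moves up to \<open>r s\<close> matter here; \<open>move\<close> needs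
          the shadows at times \<open>Suc u\<close> \<le> \<open>s\<close>, where the induction
          hypothesis applies.\<close>
        have "?c (Suc s) i = ?c s i \<or> (?c (Suc s) i \<in> E \<and> ?c s i \<inter> ?c (Suc s) i \<noteq> {})"
        proof (rule ct_legal_move[OF legal _ i])
          show "r 0 \<in> V" using r by (simp add: cr_robber_play_def)
          show "r (Suc u) = r u \<or> ({r u, r (Suc u)} \<in> E \<and> (\<forall>i<k. ?c (Suc u) i \<noteq> {r u, r (Suc u)}))"
            if "u < s" for u
            by (rule move) (use less.IH[of "Suc u"] that Suc in simp)
        qed
        then obtain v where v: "v \<in> ?c (Suc s) i" "v \<in> ?c s i" and e: "?c (Suc s) i \<in> E"
          using IH by auto
        \<comment> \<open>The old edge contains both the shadow and \<open>v\<close>, so the shared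
          vertex is within one step.\<close>
        have "v = ?p s i \<or> {?p s i, v} \<in> E"
          using simple_graph_edge_eq[OF G IH(1,2) v(2)] IH(1) by metis
        then have "?p (Suc s) i \<in> ?c (Suc s) i"
          unfolding shadow_Suc by (rule pursue_in[OF far[OF i] v(1)])
        with e show ?thesis unfolding Suc by simp
      qed
    qed
  qed
  then show "i < k \<Longrightarrow> ?c t i \<in> E \<and> ?p t i \<in> ?c t i" by blast
  show "ct_robber_play V E k \<sigma> r"
    unfolding ct_robber_play_def using move inv r by (auto simp: cr_robber_play_def)
qed

text \<open>The first step of a walk to a second vertex is such an edge. This rules out vacuous
  containment at an isolated vertex.\<close>

lemma connected_graph_incident_edge:
  assumes "connected_graph V E" "2 \<le> card V" "v \<in> V"
  obtains e where "e \<in> E" "v \<in> e"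
proof -
  have "\<not> V \<subseteq> {v}" using assms(2) card_mono[of "{v}" V] by auto
  then obtain u where "u \<in> V" "u \<noteq> v" by blast
  then have "(v, u) \<in> (adj_rel E)\<^sup>*" using assms by (simp add: connected_graph_def)
  then obtain x where "(v, x) \<in> adj_rel E"
    using \<open>u \<noteq> v\<close> by (auto elim: converse_rtranclE)
  then show ?thesis using that[of "{v, x}"] by (simp add: adj_rel_def)
qed

lemma cr_robber_play_in:
  assumes "simple_graph V E" "cr_robber_play V E r"
  shows "r t \<in> V"
proof (induction t)
  case (Suc t)
  then show ?case
    using assms simple_graph_edgeD(2)[OF assms(1)] unfolding cr_robber_play_def by metis
qed (use assms in \<open>simp add: cr_robber_play_def\<close>)

lemma cop_containable_imp_cops_win:
  assumes conn: "connected_graph V E" and card: "2 \<le> card V" and win: "cop_containable V E k"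
  shows "cops_win V E k"
proof -
  have G: "simple_graph V E" using conn by (simp add: connected_graph_def)
  obtain \<sigma> where legal: "ct_legal_strategy V E k \<sigma>"
    and cont: "\<And>r. ct_robber_play V E k \<sigma> r \<Longrightarrow> ct_contained E k \<sigma> r"
    using win unfolding cop_containable_def by blast
  have "cr_captured k (shadow E \<sigma>) r" if r: "cr_robber_play V E r" for r
  proof (rule ccontr)
    assume unc: "\<not> cr_captured k (shadow E \<sigma>) r"
    note shadow = uncaptured_shadow[OF G legal r unc]
    obtain t where t: "\<And>e. e \<in> E \<Longrightarrow> r t \<in> e \<Longrightarrow> \<exists>i<k. cops_at \<sigma> r (Suc t) i = e"
      using cont[OF shadow(2)] unfolding ct_contained_def by blast
    have stay: "r (Suc t) = r t"
      using shadow(2) t[of "{r t, r (Suc t)}"] unfolding ct_robber_play_def by blast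
    obtain e where e: "e \<in> E" "r t \<in> e"
      using connected_graph_incident_edge[OF conn card cr_robber_play_in[OF G r]] by blast
    then obtain i where i: "i < k" "cops_at \<sigma> r (Suc t) i = e" using t by blast
    have "cops_at (shadow E \<sigma>) r (Suc t) i \<noteq> r t"
      using unc i unfolding cr_captured_def by blast
    moreover have "cops_at (shadow E \<sigma>) r (Suc t) i \<in> e" using shadow(1) i by blast
    \<comment> \<open>The shadow is at the other end of \<open>e\<close>, hence adjacent to the
      robber, who stayed; \<open>shadow(3)\<close> excludes this.\<close>
    ultimately have "{cops_at (shadow E \<sigma>) r (Suc t) i, r (Suc t)} = e"
      using simple_graph_edge_eq[OF G e(1) _ e(2)] stay by metis
    with shadow(3)[OF i(1), of "Suc t"] e(1) show False by simp
  qed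
  with shadow_legal[OF G legal] show ?thesis unfolding cops_win_def by blast
qed

text \<open>\<open>cop_number\<close> ranges over positive \<open>k\<close> only. Without cops a
  resting robber is never contained, as every vertex has an edge.\<close>

lemma cop_containable_pos:
  assumes "connected_graph V E" "2 \<le> card V" "cop_containable V E k"
  shows "1 \<le> k"
proof (rule ccontr)
  assume "\<not> 1 \<le> k"
  then have k: "k = 0" by simp
  obtain v where v: "v \<in> V" using assms(2) by fastforce
  have "ct_robber_play V E k \<sigma> (\<lambda>_. v)" for \<sigma> using v by (simp add: ct_robber_play_def)
  then obtain \<sigma> where "ct_contained E k \<sigma> (\<lambda>_. v)"
    using assms(3) unfolding cop_containable_def by blast
  then show False
    using connected_graph_incident_edge[OF assms(1,2) v] k by (auto simp: ct_contained_def)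
qed


subsection \<open>Containment from a dominating set\<close>

lemma gdist_le_1D:
  assumes "gdist E u v \<le> 1"
  shows "u = v \<or> {u, v} \<in> E"
proof (rule ccontr)
  assume *: "\<not> (u = v \<or> {u, v} \<in> E)"
  have "enat 2 \<le> gdist E u v"
    unfolding gdist_def
  proof (rule INF_greatest)
    fix n assume n: "n \<in> {n. (u, v) \<in> adj_rel E ^^ n}"
    have "n \<noteq> 0" using n * by (intro notI) auto
    moreover have "n \<noteq> 1" using n * by (intro notI) (auto simp: adj_rel_def)
    ultimately show "enat 2 \<le> enat n" by simp
  qed
  then have "enat 2 \<le> 1" using assms by (rule order_trans)
  then show False by (simp add: one_enat_def)
qed

text \<open>Ensures that the minimum defining \<open>domination_number\<close> is over a nonempty
  set.\<close>

lemma dominating_set_vertices: "dominating_set V E V"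
proof -
  have "gdist E v v \<le> 1" for v
  proof -
    have "gdist E v v \<le> enat 0" unfolding gdist_def by (rule INF_lower) simp
    then show ?thesis by (simp add: zero_enat_def[symmetric])
  qed
  then show ?thesis unfolding dominating_set_def by blast
qed

lemma domination_number_attained:
  assumes "finite V"
  obtains S where "dominating_set V E S" "card S = domination_number V E"
proof -
  have "finite {S. dominating_set V E S}"
    by (rule finite_subset[of _ "Pow V"]) (use assms in \<open>auto simp: dominating_set_def\<close>)
  then have "domination_number V E \<in> card ` {S. dominating_set V E S}"
    unfolding domination_number_def using dominating_set_vertices[of V E] by (intro Min_in) auto
  then show ?thesis using that by auto
qed

text \<open>Union bound over the stars of the vertices in \<open>S\<close>.\<close>

lemma card_edges_meeting_le:
  assumes "finite V" "S \<subseteq> V"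
  shows "card {e \<in> E. e \<inter> S \<noteq> {}} \<le> max_degree V E * card S"
proof -
  have "finite S" using assms by (rule rev_finite_subset)
  have "{e \<in> E. e \<inter> S \<noteq> {}} = (\<Union>w\<in>S. {e \<in> E. w \<in> e})" by blast
  then have "card {e \<in> E. e \<inter> S \<noteq> {}} \<le> (\<Sum>w\<in>S. degree E w)"
    using card_UN_le[OF \<open>finite S\<close>] by (simp add: degree_def)
  also have "\<dots> \<le> card S * max_degree V E"
    using sum_bounded_above[of S "degree E" "max_degree V E"] assms
    by (simp add: max_degree_def subset_iff)
  finally show ?thesis by (simp add: mult.commute)
qed

lemma finite_surj_lessThan:
  assumes "finite F" "F \<noteq> {}" "card F \<le> k"
  obtains g :: "nat \<Rightarrow> 'b" where "g ` {..<k} = F"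
proof -
  obtain h where h: "bij_betw h {0..<card F} F" using ex_bij_betw_nat_finite[OF assms(1)] by blast
  have pos: "0 < card F" using assms by (simp add: card_gt_0_iff)
  \<comment> \<open>Surplus indices repeat \<open>h 0\<close>, as cops may share an edge.\<close>
  let ?g = "\<lambda>i. if i < card F then h i else h 0"
  have "?g ` {..<k} = h ` {0..<card F}"
  proof
    show "?g ` {..<k} \<subseteq> h ` {0..<card F}" using pos by auto
    show "h ` {0..<card F} \<subseteq> ?g ` {..<k}"
    proof
      fix y assume "y \<in> h ` {0..<card F}"
      then obtain i where "i < card F" "y = h i" by auto
      then show "y \<in> ?g ` {..<k}" using assms(3) by (intro image_eqI[of _ _ i]) auto
    qed
  qed
  then show ?thesis using that[of ?g] h by (simp add: bij_betw_def)
qed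

text \<open>The reply of a cop on \<open>f\<close> to a robber starting at \<open>v\<close>. An edge
  \<open>f\<close> meeting \<open>S\<close> has at most one endpoint outside \<open>S\<close>, so
  the choice is then determined.\<close>

definition close_in :: "'a set set \<Rightarrow> 'a set \<Rightarrow> 'a \<Rightarrow> 'a set \<Rightarrow> 'a set" where
  "close_in E S v f =
     (if v \<notin> S \<and> (\<exists>u. u \<in> f - S \<and> {u, v} \<in> E) then {SOME u. u \<in> f - S \<and> {u, v} \<in> E, v} else f)"

lemma close_in_legal:
  "close_in E S v f = f \<or> (close_in E S v f \<in> E \<and> f \<inter> close_in E S v f \<noteq> {})"
proof (cases "v \<notin> S \<and> (\<exists>u. u \<in> f - S \<and> {u, v} \<in> E)")
  case True
  then have "\<exists>u. u \<in> f - S \<and> {u, v} \<in> E" by blast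
  from someI_ex[OF this] show ?thesis using True by (auto simp: close_in_def)
next
  case False
  then have "close_in E S v f = f" unfolding close_in_def by (rule if_not_P)
  then show ?thesis ..
qed

lemma close_in_covers:
  assumes G: "simple_graph V E" and dom: "dominating_set V E S" and e: "e \<in> E" "v \<in> e"
  obtains f where "f \<in> E" "f \<inter> S \<noteq> {}" "close_in E S v f = e"
proof -
  obtain u where u: "e = {u, v}"
    using G e unfolding simple_graph_def by fastforce
  have uv: "u \<in> V" "v \<in> V" "u \<noteq> v" using simple_graph_edgeD[OF G] e(1) u by auto
  have "{v, v} \<notin> E" using simple_graph_edgeD(3)[OF G] by blast
  show ?thesis
  proof (cases "e \<inter> S = {}")
    case False
    \<comment> \<open>If \<open>v\<close> is outside \<open>S\<close>, it is the only such endpoint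
      of \<open>e\<close>, and \<open>{v, v}\<close> is no edge, so the cop on \<open>e\<close>
      stays.\<close>
    then have "close_in E S v e = e"
      using \<open>{v, v} \<notin> E\<close> unfolding close_in_def u by auto
    with False e(1) show ?thesis by (intro that)
  next
    case True
    obtain w where w: "w \<in> S" "gdist E u w \<le> 1"
      using dom uv unfolding dominating_set_def by blast
    then have uw: "{u, w} \<in> E" using gdist_le_1D[OF w(2)] True u by auto
    have "(x \<in> {u, w} - S \<and> {x, v} \<in> E) \<longleftrightarrow> x = u" for x
      using w(1) True u e(1) by auto
    then have "close_in E S v {u, w} = e" using True u by (simp add: close_in_def)
    with uw w(1) show ?thesis by (intro that[of "{u, w}"]) auto
  qed
qed

lemma cop_containable_dominating_set:
  assumes G: "simple_graph V E" and dom: "dominating_set V E S" and "E \<noteq> {}"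
    and k: "card {e \<in> E. e \<inter> S \<noteq> {}} \<le> k"
  shows "cop_containable V E k"
proof -
  let ?F = "{e \<in> E. e \<inter> S \<noteq> {}}"
  have "E \<subseteq> Pow V" "finite V" using G by (auto simp: simple_graph_def)
  then have "finite ?F" by (auto intro: finite_subset[of _ "Pow V"])
  moreover have "?F \<noteq> {}"
  proof -
    obtain e where "e \<in> E" using \<open>E \<noteq> {}\<close> by blast
    moreover from this obtain v where "v \<in> e" using G unfolding simple_graph_def by blast
    ultimately obtain f where "f \<in> E" "f \<inter> S \<noteq> {}" by (rule close_in_covers[OF G dom])
    then show ?thesis by blast
  qed
  ultimately obtain g where g: "g ` {..<k} = ?F" using k by (rule finite_surj_lessThan)
  \<comment> \<open>Only the robber's first position is consulted: the cops move once and then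
    rest.\<close>
  define \<sigma> where "\<sigma> h i = (case h of [] \<Rightarrow> g i | v # _ \<Rightarrow> close_in E S v (g i))" for h i
  have \<sigma>0: "cops_at \<sigma> r 0 i = g i" for r i by (simp add: cops_at_def \<sigma>_def)
  have \<sigma>Suc: "cops_at \<sigma> r (Suc t) i = close_in E S (r 0) (g i)" for r t i
    by (simp add: cops_at_def \<sigma>_def upt_rec[of 0])
  have "ct_legal_strategy V E k \<sigma>"
    unfolding ct_legal_strategy_def
  proof (intro conjI allI impI)
    show "\<sigma> [] i \<in> E" if "i < k" for i using g that by (auto simp: \<sigma>_def)
    fix r t i
    show "cops_at \<sigma> r (Suc t) i = cops_at \<sigma> r t i \<or>
      (cops_at \<sigma> r (Suc t) i \<in> E \<and> cops_at \<sigma> r t i \<inter> cops_at \<sigma> r (Suc t) i \<noteq> {})"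
      using close_in_legal[of E S "r 0" "g i"] by (cases t) (simp_all add: \<sigma>0 \<sigma>Suc)
  qed
  moreover have "ct_contained E k \<sigma> r" for r
    unfolding ct_contained_def
  proof (rule exI[of _ 0], intro ballI impI)
    fix e assume "e \<in> E" "r 0 \<in> e"
    then obtain f where "f \<in> E" "f \<inter> S \<noteq> {}" and e: "close_in E S (r 0) f = e"
      by (rule close_in_covers[OF G dom])
    then have "f \<in> g ` {..<k}" using g by simp
    with e show "\<exists>i<k. cops_at \<sigma> r (Suc 0) i = e" unfolding \<sigma>Suc by blast
  qed
  ultimately show ?thesis unfolding cop_containable_def by blast
qed

text \<open>Without edges no cop can be placed, but zero cops contain the robber vacuously.\<close>

lemma cop_containable_edgeless: "cop_containable V {} 0"
  unfolding cop_containable_def ct_legal_strategy_def ct_contained_def by simp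

text \<open>The condition \<open>2 \<le> card V\<close> matters: on a single vertex zero cops
  contain the robber, while the cop number is at least 1.\<close>

theorem theorem2p1:
  fixes V :: "'a set" and E :: "'a set set"
  assumes "connected_graph V E"
  shows "(2 \<le> card V \<longrightarrow> cop_number V E \<le> containability_number V E)
       \<and> containability_number V E \<le> enat (max_degree V E * domination_number V E)"
proof
  show "2 \<le> card V \<longrightarrow> cop_number V E \<le> containability_number V E"
    unfolding cop_number_def containability_number_def
    using cop_containable_imp_cops_win[OF assms] cop_containable_pos[OF assms]
    by (intro impI INF_superset_mono) auto
  have G: "simple_graph V E" using assms by (simp add: connected_graph_def)
  then have "finite V" by (simp add: simple_graph_def)
  then obtain S where S: "dominating_set V E S" "card S = domination_number V E"
    by (rule domination_number_attained)
  let ?k = "max_degree V E * domination_number V E"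
  obtain k where "cop_containable V E k" "k \<le> ?k"
  proof (cases "E = {}")
    case True
    then show ?thesis by (intro that[of 0]) (simp_all add: cop_containable_edgeless)
  next
    case False
    have "card {e \<in> E. e \<inter> S \<noteq> {}} \<le> ?k"
      using card_edges_meeting_le[OF \<open>finite V\<close>, of S E] S by (simp add: dominating_set_def)
    then show ?thesis
      using that[of ?k] cop_containable_dominating_set[OF G S(1) False] by simp
  qed
  then have "containability_number V E \<le> enat k" "enat k \<le> enat ?k"
    unfolding containability_number_def by (auto intro: INF_lower)
  then show "containability_number V E \<le> enat ?k" by (rule order_trans)
qed

end
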